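(* Let $X$ be a Banach space over $\mathbb{K}\in\{\mathbb{R},\mathbb{C}\}$, let $\Lambda$ be a nonempty set, let $X_\lambda$, $\lambda\in\Lambda$, be closed linear subspaces of $X$ forming an absolutely representing family of subspaces (ARFS) in $X$, and let $\Lambda'$ be a subset of $\Lambda$. Suppose that for every $\delta>0$ there is a closed linear subspace $L$ of $X$ with $L\subset\mathcal{L}(X_\lambda\mid\lambda\in\Lambda\setminus\Lambda')$ such that $$\rho_0(\langle X_\lambda\mid\lambda\in\Lambda'\rangle,L)<\delta.$$ Then the family $(X_\lambda)_{\lambda\in\Lambda\setminus\Lambda'}$ is an ARFS in $X$.
   Context: A family $(X_\lambda)_{\lambda\in\Lambda}$ of closed linear subspaces of $X$ is called an absolutely representing family of subspaces (ARFS) in $X$ if for every $x\in X$ there exist $x_\lambda\in X_\lambda$, $\lambda\in\Lambda$, such that $\sum_{\lambda\in\Lambda}\|x_\lambda\|<\infty$ and $x=\sum_{\lambda\in\Lambda}x_\lambda$ (an empty sum is $0$). $\mathcal{L}(X_\lambda\mid\lambda\in\Lambda\setminus\Lambda')$ is the (algebraic, not closed) linear span of $\bigcup_{\lambda\in\Lambda\setminus\Lambda'}X_\lambda$, while $\langle X_\lambda\mid\lambda\in\Lambda'\rangle$ is the closed linear span of $\bigcup_{\lambda\in\Lambda'}X_\lambda$. For closed linear subspaces $Y,Z\subset X$, $\rho_0(Y,Z)=\sup\{d(y,Z)\mid y\in Y,\ \|y\|=1\}$, where $d(y,Z)=\inf_{z\in Z}\|y-z\|$; if $Y=\{0\}$,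 then $\rho_0(Y,Z)=0$. *)

theory Defs
  imports "HOL-Analysis.Analysis"
begin

text \<open>
  A Banach space over \<open>\<real>\<close> or \<open>\<complex>\<close>.  The class \<^class>\<open>banach\<close> provides addition, the norm,
  completeness and the underlying real structure; \<open>smul\<close> is the multiplication by scalars from
  \<open>'k\<close>.  By the theorem of Frobenius and Mazur, a field of class \<^class>\<open>real_normed_field\<close>
  is \<open>\<real>\<close> or \<open>\<complex>\<close> with the usual absolute value, so \<open>'k\<close> ranges over exactly these two fields.
  The assumption \<open>smul_of_real\<close> is no restriction: an additive group has at most one
  scalar multiplication by \<open>\<real>\<close> that is compatible with a given norm.
\<close>

locale banach_over = vector_space smul
  for smul :: "'k::real_normed_field \<Rightarrow> 'a::banach \<Rightarrow> 'a" +
  assumes smul_of_real: "smul (of_real r) x = r *\<^sub>R x"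
    and norm_smul: "norm (smul c x) = norm c * norm x"

lemma banach_over_real: "banach_over (scaleR :: real \<Rightarrow> 'a::banach \<Rightarrow> 'a)"
  by unfold_locales (simp_all add: algebra_simps)

lemma banach_over_complex: "banach_over ((*) :: complex \<Rightarrow> complex \<Rightarrow> complex)"
  by unfold_locales (simp_all add: algebra_simps scaleR_conv_of_real norm_mult)

definition closed_subspace :: "('k::real_normed_field \<Rightarrow> 'a::banach \<Rightarrow> 'a) \<Rightarrow> 'a set \<Rightarrow> bool" where
  "closed_subspace smul Y \<longleftrightarrow> module.subspace smul Y \<and> closed Y"

definition closed_span :: "('k::real_normed_field \<Rightarrow> 'a::banach \<Rightarrow> 'a) \<Rightarrow> 'a set \<Rightarrow> 'a set" where
  "closed_span smul S = closure (module.span smul S)"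

text \<open>Absolutely representing family of subspaces, indexed by an arbitrary, possibly empty, set.\<close>

definition arfs ::
  "('k::real_normed_field \<Rightarrow> 'a::banach \<Rightarrow> 'a) \<Rightarrow> 'i set \<Rightarrow> ('i \<Rightarrow> 'a set) \<Rightarrow> bool" where
  "arfs smul I X \<longleftrightarrow>
     (\<forall>i\<in>I. closed_subspace smul (X i)) \<and>
     (\<forall>x. \<exists>u. (\<forall>i\<in>I. u i \<in> X i) \<and> (\<lambda>i. norm (u i)) summable_on I \<and> (u has_sum x) I)"

text \<open>
  For subspaces \<open>Y\<close> and \<open>Z\<close> the supremum is over a set bounded by 1, which is nonempty unless
  \<open>Y = {0}\<close>.
\<close>

definition rho0 :: "'a::banach set \<Rightarrow> 'a set \<Rightarrow> real" where
  "rho0 Y Z = (if Y = {0} then 0 else Sup {infdist y Z | y. y \<in> Y \<and> norm y = 1})"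

end

theory Submission
  imports Defs
begin

text \<open>
  By a Baire category argument absolute representations can be chosen with norm sums bounded by
  \<open>C \<parallel>x\<parallel>\<close> on all of \<open>X\<close>; the same argument applies to a closed subspace \<open>L\<close> of the algebraic
  span of the remaining subspaces, with another constant \<open>M\<close>.  As \<open>C\<close> does not depend on
  \<open>L\<close>, one may take \<open>L\<close> with \<open>\<rho>\<^sub>0 < 1 / (2 (C + 1))\<close>.  Replacing the \<open>\<Lambda>'\<close>-part of a
  representation of \<open>x\<close> by a nearby element of \<open>L\<close> leaves an error of norm at most \<open>\<parallel>x\<parallel> / 2\<close>,
  and iteration yields a representation without \<open>\<Lambda>'\<close>.
\<close>

section \<open>Absolute representations with a bound on the norm sum\<close>

text \<open>This is the image, under the sum map, of the ball of radius \<open>K\<close> in the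
  l1-direct sum of the \<open>X i\<close>. Stating it pointwise avoids constructing that Banach
  space.\<close>

definition abs_rep :: "('i \<Rightarrow> 'a::banach set) \<Rightarrow> 'i set \<Rightarrow> real \<Rightarrow> 'a \<Rightarrow> bool" where
  "abs_rep X I K x \<longleftrightarrow>
     (\<exists>u. (\<forall>i\<in>I. u i \<in> X i) \<and> (\<lambda>i. norm (u i)) summable_on I \<and>
          (\<Sum>\<^sub>\<infinity>i\<in>I. norm (u i)) \<le> K \<and> (u has_sum x) I)"

lemma abs_rep_mono: "abs_rep X I K x \<Longrightarrow> K \<le> K' \<Longrightarrow> abs_rep X I K' x"
  unfolding abs_rep_def by (elim exE conjE, rule exI) auto

lemma abs_rep_norm_le:
  assumes "abs_rep X I K x"
  shows "norm x \<le> K"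
proof -
  obtain u where u: "(\<lambda>i. norm (u i)) summable_on I"
    "(\<Sum>\<^sub>\<infinity>i\<in>I. norm (u i)) \<le> K" "(u has_sum x) I"
    using assms unfolding abs_rep_def by blast
  have "norm x \<le> (\<Sum>\<^sub>\<infinity>i\<in>I. norm (u i))"
    by (rule norm_infsum_le[OF u(3) has_sum_infsum[OF u(1)]]) simp
  then show ?thesis using u(2) by simp
qed

section \<open>Linear combinations and series of representations\<close>

text \<open>Real subspaces keep this context independent of \<open>smul\<close>. Closedness enters
  through \<open>abs_rep_series\<close>, where components arise as limits.\<close>

locale closed_subspaces =
  fixes X :: "'i \<Rightarrow> 'a::banach set" and I :: "'i set"
  assumes subspace_X: "i \<in> I \<Longrightarrow> subspace (X i)"
    and closed_X: "i \<in> I \<Longrightarrow> closed (X i)"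
begin

lemma abs_rep_add:
  assumes "abs_rep X I K x" "abs_rep X I K' y"
  shows "abs_rep X I (K + K') (x + y)"
proof -
  obtain u where u: "\<forall>i\<in>I. u i \<in> X i" "(\<lambda>i. norm (u i)) summable_on I"
    "(\<Sum>\<^sub>\<infinity>i\<in>I. norm (u i)) \<le> K" "(u has_sum x) I"
    using assms(1) unfolding abs_rep_def by blast
  obtain v where v: "\<forall>i\<in>I. v i \<in> X i" "(\<lambda>i. norm (v i)) summable_on I"
    "(\<Sum>\<^sub>\<infinity>i\<in>I. norm (v i)) \<le> K'" "(v has_sum y) I"
    using assms(2) unfolding abs_rep_def by blast
  have s: "(\<lambda>i. norm (u i) + norm (v i)) summable_on I"
    using u(2) v(2) by (rule summable_on_add)
  have n: "(\<lambda>i. norm (u i + v i)) summable_on I"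
    by (rule Infinite_Sum.abs_summable_on_comparison_test'[OF s]) (rule norm_triangle_ineq)
  have "(\<Sum>\<^sub>\<infinity>i\<in>I. norm (u i + v i)) \<le> (\<Sum>\<^sub>\<infinity>i\<in>I. norm (u i) + norm (v i))"
    by (rule infsum_mono[OF n s]) (rule norm_triangle_ineq)
  also have "\<dots> \<le> K + K'"
    using u(3) v(3) by (simp add: infsum_add u(2) v(2))
  finally show ?thesis
    unfolding abs_rep_def using u(1,4) v(1,4) n
    by (intro exI[of _ "\<lambda>i. u i + v i"]) (auto intro: has_sum_add subspace_add subspace_X)
qed

lemma abs_rep_scaleR:
  assumes "abs_rep X I K x"
  shows "abs_rep X I (\<bar>c\<bar> * K) (c *\<^sub>R x)"
proof -
  obtain u where u: "\<forall>i\<in>I. u i \<in> X i" "(\<lambda>i. norm (u i)) summable_on I"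
    "(\<Sum>\<^sub>\<infinity>i\<in>I. norm (u i)) \<le> K" "(u has_sum x) I"
    using assms unfolding abs_rep_def by blast
  then show ?thesis
    unfolding abs_rep_def
    by (intro exI[of _ "\<lambda>i. c *\<^sub>R u i"])
      (auto intro: has_sum_scaleR subspace_scale subspace_X summable_on_cmult_right mult_left_mono
        simp: infsum_cmult_right')
qed

lemma abs_rep_0: "abs_rep X I 0 0"
  unfolding abs_rep_def by (intro exI[of _ "\<lambda>_. 0"]) (auto intro: subspace_0 subspace_X)

lemma abs_rep_diff: "abs_rep X I K x \<Longrightarrow> abs_rep X I K' y \<Longrightarrow> abs_rep X I (K + K') (x - y)"
  using abs_rep_add[of K x K' "- y"] abs_rep_scaleR[of K' y "-1"] by simp

lemma abs_rep_single:
  assumes "i \<in> I" "x \<in> X i"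
  shows "abs_rep X I (norm x) x"
proof -
  have "((\<lambda>j. norm (if j = i then x else 0)) has_sum norm x) I"
    by (rule has_sum_finite_neutralI[of "{i}"]) (use assms in auto)
  moreover have "((\<lambda>j. if j = i then x else 0) has_sum x) I"
    by (rule has_sum_finite_neutralI[of "{i}"]) (use assms in auto)
  ultimately show ?thesis
    unfolding abs_rep_def using assms
    by (intro exI[of _ "\<lambda>j. if j = i then x else 0"])
      (auto simp: has_sum_iff intro: subspace_0 subspace_X)
qed

text \<open>This plays the role of completeness of the l1-sum: the representations of all
  \<open>a n\<close> form one absolutely summable double family, which Fubini allows to be summed
  over \<open>n\<close> first.\<close>

lemma abs_rep_series:
  assumes rep: "\<And>n::nat. abs_rep X I (K n) (a n)"
    and K: "summable K" and a: "a sums x"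
  shows "abs_rep X I (suminf K) x"
proof -
  obtain u where u: "\<And>n i. i \<in> I \<Longrightarrow> u n i \<in> X i" "\<And>n. (\<lambda>i. norm (u n i)) summable_on I"
    "\<And>n. (\<Sum>\<^sub>\<infinity>i\<in>I. norm (u n i)) \<le> K n" "\<And>n. (u n has_sum a n) I"
    using rep unfolding abs_rep_def by metis
  have K0: "0 \<le> K n" for n
    by (rule order_trans[OF infsum_nonneg u(3)]) simp
  have "(K has_sum suminf K) UNIV"
    using K K0 by (intro norm_summable_imp_has_sum summable_sums) simp_all
  then have Ks: "K summable_on UNIV" and Ki: "infsum K UNIV = suminf K"
    by (rule has_sum_imp_summable, rule infsumI)
  define N where "N = (\<lambda>n. \<Sum>\<^sub>\<infinity>i\<in>I. norm (u n i))"
  have N: "0 \<le> N n" "N n \<le> K n" for n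
    unfolding N_def by (rule infsum_nonneg, simp, rule u(3))
  have Ns: "N summable_on UNIV"
    by (rule summable_on_comparison_test[OF Ks N(2,1)])
  then have "(\<lambda>n. norm (N n)) summable_on UNIV"
    by (simp only: real_norm_def abs_of_nonneg N(1))
  \<comment> \<open>Each row is absolutely summable, and the row sums \<open>N n\<close> are
    dominated by \<open>K n\<close>.\<close>
  with u(2) have nprod: "(\<lambda>p. norm (u (fst p) (snd p))) summable_on (UNIV \<times> I)"
    by (subst Infinite_Sum.abs_summable_on_Sigma_iff)
      (simp only: fst_conv snd_conv N_def, blast)
  have nprod': "(\<lambda>p. norm (u (snd p) (fst p))) summable_on (I \<times> UNIV)"
    using summable_on_swap[of "\<lambda>p. norm (u (snd p) (fst p))" I UNIV] nprod
    by (simp only: case_prod_unfold fst_conv snd_conv)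
  have prod: "(\<lambda>(n, i). u n i) summable_on (UNIV \<times> I)"
    unfolding case_prod_unfold by (rule Infinite_Sum.abs_summable_summable[OF nprod])
  \<comment> \<open>Read with the index order swapped, the same summability yields summable columns
    and summable column sums.\<close>
  note prod' = nprod'[unfolded Infinite_Sum.abs_summable_on_Sigma_iff fst_conv snd_conv]
  define w where "w = (\<lambda>i. \<Sum>\<^sub>\<infinity>n. u n i)"
  have un: "(\<lambda>n. norm (u n i)) summable_on UNIV" if "i \<in> I" for i
    using prod' that by blast
  have wX: "w i \<in> X i" if i: "i \<in> I" for i
  proof -
    have "(\<lambda>n. u n i) sums w i"
      unfolding w_def
      by (rule has_sum_imp_sums[OF has_sum_infsum[OF Infinite_Sum.abs_summable_summable[OF un[OF i]]]])
    then have "(\<lambda>m. \<Sum>n<m. u n i) \<longlonglongrightarrow> w i"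
      by (simp only: sums_def)
    moreover have "(\<Sum>n<m. u n i) \<in> X i" for m
      by (rule subspace_sum[OF subspace_X[OF i] u(1)[OF i]])
    ultimately show ?thesis
      by (rule closed_sequentially[OF closed_X[OF i], rotated])
  qed
  have bound: "(\<lambda>i. \<Sum>\<^sub>\<infinity>n. norm (u n i)) summable_on I"
    using prod'[THEN conjunct2] by (simp only: real_norm_def abs_of_nonneg infsum_nonneg norm_ge_zero)
  have wle: "norm (w i) \<le> (\<Sum>\<^sub>\<infinity>n. norm (u n i))" if "i \<in> I" for i
    unfolding w_def by (rule Infinite_Sum.norm_infsum_bound[OF un[OF that]])
  have ws: "(\<lambda>i. norm (w i)) summable_on I"
    by (rule Infinite_Sum.abs_summable_on_comparison_test'[OF bound wle])
  have "(\<Sum>\<^sub>\<infinity>i\<in>I. norm (w i)) \<le> (\<Sum>\<^sub>\<infinity>i\<in>I. \<Sum>\<^sub>\<infinity>n. norm (u n i))"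
    by (rule infsum_mono[OF ws bound wle])
  also have "\<dots> = (\<Sum>\<^sub>\<infinity>n. \<Sum>\<^sub>\<infinity>i\<in>I. norm (u n i))"
    using nprod by (intro infsum_swap_banach[symmetric]) (simp only: case_prod_unfold)
  also have "\<dots> \<le> infsum K UNIV"
    by (rule infsum_mono[OF Ns[unfolded N_def] Ks u(3)])
  finally have le: "(\<Sum>\<^sub>\<infinity>i\<in>I. norm (w i)) \<le> suminf K"
    by (simp add: Ki)
  \<comment> \<open>Absolute convergence turns the ordered sum of \<open>a\<close> into an unordered
    one, as the exchange of sums requires.\<close>
  have an: "summable (\<lambda>n. norm (a n))"
    by (rule summable_comparison_test'[OF K, of 0]) (simp add: abs_rep_norm_le[OF rep])
  have "infsum w I = (\<Sum>\<^sub>\<infinity>n. \<Sum>\<^sub>\<infinity>i\<in>I. u n i)"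
    unfolding w_def by (rule infsum_swap_banach[symmetric, OF prod])
  also have "\<dots> = (\<Sum>\<^sub>\<infinity>n. a n)"
    by (simp add: infsumI[OF u(4)])
  also have "\<dots> = x"
    using norm_summable_imp_has_sum[OF an a] by (rule infsumI)
  finally have "(w has_sum x) I"
    using has_sum_infsum[OF Infinite_Sum.abs_summable_summable[OF ws]] by simp
  then show ?thesis
    unfolding abs_rep_def using wX ws le by blast
qed

section \<open>Successive approximation and the open mapping argument\<close>

text \<open>Each correction at least halves the norm of the residual, so the corrections cost at
  most \<open>C * norm x * (1 / 2) ^ n\<close>; the geometric series gives the factor 2, and the
  corrections telescope to \<open>x\<close>.\<close>

lemma abs_rep_iterate:
  assumes V: "\<And>v a. v \<in> V \<Longrightarrow> a \<in> V \<Longrightarrow> v - a \<in> V" and "0 \<le> C"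
    and approx: "\<And>v. v \<in> V \<Longrightarrow> \<exists>a\<in>V. abs_rep X I (C * norm v) a \<and> norm (v - a) \<le> norm v / 2"
    and x: "x \<in> V"
  shows "abs_rep X I (2 * C * norm x) x"
proof -
  obtain f where f: "\<And>v. v \<in> V \<Longrightarrow> f v \<in> V" "\<And>v. v \<in> V \<Longrightarrow> abs_rep X I (C * norm v) (f v)"
    "\<And>v. v \<in> V \<Longrightarrow> norm (v - f v) \<le> norm v / 2"
    using approx by metis
  \<comment> \<open>\<open>r n\<close> is the residual left after \<open>n\<close>
    corrections.\<close>
  define r where "r = rec_nat x (\<lambda>_ v. v - f v)"
  have r0: "r 0 = x" and rS: "r (Suc n) = r n - f (r n)" for n
    by (simp_all add: r_def)
  have rV: "r n \<in> V" for n
    by (induction n) (auto simp: r0 rS x V f(1))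
  have rn: "norm (r n) \<le> norm x * (1 / 2) ^ n" for n
  proof (induction n)
    case (Suc n)
    then show ?case using f(3)[OF rV[of n]] by (simp add: rS)
  qed (simp add: r0)
  have geo: "(\<lambda>n. C * (norm x * (1 / 2) ^ n)) sums (2 * C * norm x)"
    using sums_mult[OF geometric_sums[of "1 / 2 :: real"], of "C * norm x"]
    by (simp add: ac_simps)
  have "r \<longlonglongrightarrow> 0"
  proof (rule tendsto_0_le)
    show "(\<lambda>n. (1 / 2 :: real) ^ n) \<longlonglongrightarrow> 0"
      by (intro LIMSEQ_power_zero) simp
    show "\<forall>\<^sub>F n in sequentially. norm (r n) \<le> norm ((1 / 2 :: real) ^ n) * norm x"
      using rn by (simp add: mult.commute)
  qed
  then have "(\<lambda>n. x - r n) \<longlonglongrightarrow> x"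
    using tendsto_diff[OF tendsto_const[of x]] by fastforce
  moreover have "(\<Sum>k<n. f (r k)) = x - r n" for n
    by (induction n) (simp_all add: r0 rS)
  ultimately have "(\<lambda>n. f (r n)) sums x"
    by (simp add: sums_def)
  moreover have "abs_rep X I (C * (norm x * (1 / 2) ^ n)) (f (r n))" for n
    using f(2)[OF rV[of n]] by (rule abs_rep_mono) (intro mult_left_mono rn \<open>0 \<le> C\<close>)
  ultimately show ?thesis
    using abs_rep_series[of "\<lambda>n. C * (norm x * (1 / 2) ^ n)" "\<lambda>n. f (r n)" x] geo
    by (simp add: sums_iff)
qed

text \<open>Baire's theorem makes some \<open>closure (A n)\<close> contain a relative ball of
  \<open>V\<close>. Differences of points of \<open>A n\<close> then approximate small vectors, and
  \<open>abs_rep_iterate\<close> turns approximation into exact representation.\<close>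

lemma abs_rep_open_mapping:
  assumes "subspace V" "closed V" and rep: "\<And>v. v \<in> V \<Longrightarrow> \<exists>K. abs_rep X I K v"
  shows "\<exists>C\<ge>0. \<forall>v\<in>V. abs_rep X I (C * norm v) v"
proof -
  define A where "A n = {a \<in> V. abs_rep X I (real n) a}" for n
  have clA: "closure (A n) \<subseteq> V" for n
    by (rule closure_minimal) (auto simp: A_def \<open>closed V\<close>)
  have "V \<subseteq> (\<Union>n. closure (A n))"
  proof
    fix v assume v: "v \<in> V"
    obtain K where "abs_rep X I K v" using rep[OF v] ..
    moreover obtain n where "K \<le> real n" using real_arch_simple by blast
    ultimately have "v \<in> A n" using v by (auto simp: A_def intro: abs_rep_mono)
    then show "v \<in> (\<Union>n. closure (A n))" using closure_subset by blast
  qed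
  with clA have un: "(\<Union>n. closure (A n)) = V" by blast
  have "\<exists>n. top_of_set V interior_of closure (A n) \<noteq> {}"
  proof (rule ccontr)
    assume "\<not> ?thesis"
    \<comment> \<open>As a closed subset of a Banach space, \<open>V\<close> is completely
      metrizable, so Baire's theorem applies inside \<open>V\<close>.\<close>
    then have "top_of_set V interior_of \<Union>(range (\<lambda>n. closure (A n))) = {}"
      using clA \<open>closed V\<close>
      by (intro Baire_category_alt disjI1 completely_metrizable_space_closedin
          completely_metrizable_space_euclidean)
        (auto simp: closed_subset)
    then have "V = {}" using un interior_of_topspace[of "top_of_set V"] by simp
    then show False using subspace_0[OF \<open>subspace V\<close>] by simp
  qed
  then obtain n x0 T where "openin (top_of_set V) T" "x0 \<in> T" "T \<subseteq> closure (A n)"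
    unfolding interior_of_def by blast
  then obtain r where r: "r > 0" "ball x0 r \<inter> V \<subseteq> closure (A n)" and x0: "x0 \<in> V"
    unfolding openin_contains_ball by (meson order_trans subsetD)
  \<comment> \<open>A difference of two elements of \<open>A n\<close> costs \<open>2 * n\<close>;
    rescaling by \<open>inverse t = 2 * norm v / r\<close> gives this constant.\<close>
  define C where "C = 4 * real n / r"
  have C0: "0 \<le> C" using r by (simp add: C_def)
  have "\<exists>a\<in>V. abs_rep X I (C * norm v) a \<and> norm (v - a) \<le> norm v / 2" if v: "v \<in> V" for v
  proof (cases "v = 0")
    case True
    then show ?thesis using abs_rep_0 v by auto
  next
    case False
    \<comment> \<open>This gives \<open>t *\<^sub>R v\<close> norm \<open>r / 2\<close>, so that
      \<open>x0 + t *\<^sub>R v\<close> stays in the ball.\<close>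
    define t where "t = r / (2 * norm v)"
    have t: "t > 0" using False r by (simp add: t_def)
    have "x0 + t *\<^sub>R v \<in> ball x0 r \<inter> V"
      using r False x0 v \<open>subspace V\<close> by (auto simp: t_def dist_norm subspace_add subspace_scale)
    then obtain a where a: "a \<in> A n" "dist a (x0 + t *\<^sub>R v) < r / 8"
      using r closure_approachable[of "x0 + t *\<^sub>R v"] by (metis divide_pos_pos subsetD zero_less_numeral)
    have "x0 \<in> ball x0 r \<inter> V" using r x0 by simp
    then obtain b where b: "b \<in> A n" "dist b x0 < r / 8"
      using r closure_approachable[of x0] by (metis divide_pos_pos subsetD zero_less_numeral)
    \<comment> \<open>Subtracting \<open>b\<close> cancels the centre \<open>x0\<close>. The two
      errors of \<open>r / 8\<close>, multiplied by \<open>inverse t\<close>, add up to at most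
      \<open>norm v / 2\<close>.\<close>
    define d where "d = inverse t *\<^sub>R (a - b)"
    have "d \<in> V"
      using a(1) b(1) \<open>subspace V\<close> by (simp add: d_def A_def subspace_scale subspace_diff)
    moreover have "abs_rep X I (C * norm v) d"
    proof -
      have "abs_rep X I (\<bar>inverse t\<bar> * (real n + real n)) d"
        unfolding d_def using a(1) b(1) by (intro abs_rep_scaleR abs_rep_diff) (auto simp: A_def)
      moreover have "\<bar>inverse t\<bar> * (real n + real n) = C * norm v"
        using t r False by (simp add: t_def C_def field_simps)
      ultimately show ?thesis by simp
    qed
    moreover have "norm (v - d) \<le> norm v / 2"
    proof -
      have "v - d = inverse t *\<^sub>R ((x0 + t *\<^sub>R v - a) + (b - x0))"
        using t by (simp add: d_def algebra_simps)
      then have "norm (v - d) = inverse t * norm ((x0 + t *\<^sub>R v - a) + (b - x0))"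
        using t by simp
      also have "\<dots> \<le> inverse t * (r / 4)"
      proof (rule mult_left_mono)
        show "norm ((x0 + t *\<^sub>R v - a) + (b - x0)) \<le> r / 4"
          using norm_triangle_ineq[of "x0 + t *\<^sub>R v - a" "b - x0"] a(2) b(2)
          by (simp add: dist_norm norm_minus_commute)
      qed (use t in simp)
      also have "\<dots> = norm v / 2" using r False by (simp add: t_def field_simps)
      finally show ?thesis .
    qed
    ultimately show ?thesis by blast
  qed
  then have "abs_rep X I (2 * C * norm v) v" if "v \<in> V" for v
    using that abs_rep_iterate[of V C v] C0 \<open>subspace V\<close> by (simp add: subspace_diff)
  then show ?thesis using C0 by (intro exI[of _ "2 * C"]) auto
qed

end

section \<open>The link with ARFS and the splitting of the index set\<close>

text \<open>The norm sum itself serves as \<open>K\<close>.\<close>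

lemma arfs_iff_abs_rep:
  "arfs smul I X \<longleftrightarrow> (\<forall>i\<in>I. closed_subspace smul (X i)) \<and> (\<forall>x. \<exists>K. abs_rep X I K x)"
  unfolding arfs_def abs_rep_def by fast

text \<open>Restricting an absolutely summable family to part of the index set does not increase its
  norm sum, so both parts inherit \<open>K\<close>.\<close>

lemma abs_rep_Diff:
  assumes "abs_rep X I K x" "J \<subseteq> I"
  obtains y z where "x = y + z" "abs_rep X J K y" "abs_rep X (I - J) K z"
proof -
  obtain u where u: "\<forall>i\<in>I. u i \<in> X i" "(\<lambda>i. norm (u i)) summable_on I"
    "(\<Sum>\<^sub>\<infinity>i\<in>I. norm (u i)) \<le> K" "(u has_sum x) I"
    using assms(1) unfolding abs_rep_def by blast
  have part: "abs_rep X H K (infsum u H)" "(u has_sum infsum u H) H" if H: "H \<subseteq> I" for H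
  proof -
    have s: "(\<lambda>i. norm (u i)) summable_on H"
      using u(2) H by (rule summable_on_subset)
    show h: "(u has_sum infsum u H) H"
      by (rule has_sum_infsum[OF Infinite_Sum.abs_summable_summable[OF s]])
    have "(\<Sum>\<^sub>\<infinity>i\<in>H. norm (u i)) \<le> (\<Sum>\<^sub>\<infinity>i\<in>I. norm (u i))"
      by (rule infsum_mono2[OF s u(2) H]) simp
    then show "abs_rep X H K (infsum u H)"
      unfolding abs_rep_def using u(1,3) s h H by (intro exI[of _ u]) auto
  qed
  have "(u has_sum (infsum u J + infsum u (I - J))) (J \<union> (I - J))"
    using assms(2) by (intro has_sum_Un_disjoint part(2)) auto
  then have "x = infsum u J + infsum u (I - J)"
    using assms(2) has_sum_unique[OF u(4)] by (simp add: Un_absorb1)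
  then show ?thesis using that part(1) assms(2) by blast
qed

section \<open>Spans over \<open>'k\<close> and approximation through \<open>rho0\<close>\<close>

context banach_over
begin

lemma subspace_imp_real_subspace: "subspace V \<Longrightarrow> Real_Vector_Spaces.subspace V"
  by (rule Real_Vector_Spaces.subspaceI)
    (auto simp: subspace_0 subspace_add subspace_scale simp flip: smul_of_real)

text \<open>The finite partial sums lie in the span and converge to \<open>x\<close>.\<close>

lemma abs_rep_in_closed_span:
  assumes "abs_rep X I K x"
  shows "x \<in> closed_span smul (\<Union>i\<in>I. X i)"
proof -
  obtain u where u: "\<forall>i\<in>I. u i \<in> X i" "(u has_sum x) I"
    using assms unfolding abs_rep_def by blast
  show ?thesis
    unfolding closed_span_def
  proof (rule Lim_in_closed_set)
    show "(sum u \<longlongrightarrow> x) (finite_subsets_at_top I)"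
      using u(2) by (simp add: has_sum_def)
    show "\<forall>\<^sub>F F in finite_subsets_at_top I. sum u F \<in> closure (span (\<Union>i\<in>I. X i))"
    proof (rule eventually_finite_subsets_at_top_weakI)
      fix F assume F: "finite F" "F \<subseteq> I"
      have "sum u F \<in> span (\<Union>i\<in>I. X i)"
        using u(1) F by (intro span_sum span_base) auto
      then show "sum u F \<in> closure (span (\<Union>i\<in>I. X i))"
        using closure_subset by blast
    qed
  qed auto
qed

text \<open>An element of the algebraic span is a finite sum of vectors from the \<open>X i\<close>.
  Nothing uniform is claimed for \<open>K\<close>; on a closed subspace
  \<open>abs_rep_open_mapping\<close> supplies uniformity.\<close>

lemma span_imp_abs_rep:
  assumes sub: "\<And>i. i \<in> I \<Longrightarrow> closed_subspace smul (X i)"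
    and x: "x \<in> span (\<Union>i\<in>I. X i)"
  shows "\<exists>K. abs_rep X I K x"
proof -
  interpret closed_subspaces X I
    using sub by unfold_locales (auto simp: closed_subspace_def subspace_imp_real_subspace)
  show ?thesis
    using x
  proof (induction rule: span_induct_alt)
    case base
    show ?case using abs_rep_0 by blast
  next
    case (step c x y)
    then obtain i K where "i \<in> I" "x \<in> X i" "abs_rep X I K y" by blast
    moreover from this have "smul c x \<in> X i"
      using sub[of i] subspace_scale by (simp add: closed_subspace_def)
    ultimately show ?case using abs_rep_add abs_rep_single by blast
  qed
qed

text \<open>Normalise \<open>y\<close>, use the strict inequality to pick a point of
  \<open>L\<close> closer than \<open>\<delta>\<close> although the infimum need not be attained,
  and scale back.\<close>

lemma rho0_less_approx:
  assumes Y: "Real_Vector_Spaces.subspace Y" and L: "Real_Vector_Spaces.subspace L"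
    and \<delta>: "rho0 Y L < \<delta>" and y: "y \<in> Y"
  shows "\<exists>z\<in>L. norm (y - z) \<le> \<delta> * norm y"
proof (cases "y = 0")
  case True
  then show ?thesis using L by (intro bexI[of _ 0]) (auto simp: Real_Vector_Spaces.subspace_0)
next
  case False
  define e where "e = y /\<^sub>R norm y"
  have 0: "0 \<in> L" using L by (rule Real_Vector_Spaces.subspace_0)
  have e: "e \<in> Y" "norm e = 1"
    using False y Y by (auto simp: e_def Real_Vector_Spaces.subspace_scale)
  \<comment> \<open>The supremum is an upper bound only for a bounded set; 1 bounds it because
    \<open>0 \<in> L\<close>.\<close>
  have "bdd_above {infdist y L | y. y \<in> Y \<and> norm y = 1}"
  proof (rule bdd_aboveI)
    fix r assume "r \<in> {infdist y L | y. y \<in> Y \<and> norm y = 1}"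
    then obtain y where "r = infdist y L" "norm y = 1" by blast
    then show "r \<le> 1" using infdist_le[OF 0, of y] by simp
  qed
  then have "infdist e L \<le> Sup {infdist y L | y. y \<in> Y \<and> norm y = 1}"
    using e by (intro cSup_upper) auto
  also have "\<dots> = rho0 Y L"
    using y False by (auto simp: rho0_def)
  finally have "(INF z\<in>L. dist e z) < \<delta>"
    using \<delta> 0 infdist_notempty[of L e] by force
  then obtain z where z: "z \<in> L" "dist e z < \<delta>"
    using 0 by (subst (asm) cINF_less_iff) auto
  have "y - norm y *\<^sub>R z = norm y *\<^sub>R (e - z)"
    using False by (simp add: e_def algebra_simps)
  then have "norm (y - norm y *\<^sub>R z) = norm y * dist e z"
    by (simp add: dist_norm)
  also have "\<dots> \<le> \<delta> * norm y"
    using mult_right_mono[OF less_imp_le[OF z(2)] norm_ge_zero[of y]] by (simp add: mult.commute)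
  finally show ?thesis
    using z(1) L Real_Vector_Spaces.subspace_scale by blast
qed

lemma real_subspace_closed_span: "Real_Vector_Spaces.subspace (closed_span smul S)"
proof -
  have S: "Real_Vector_Spaces.subspace (span S)"
    by (intro subspace_imp_real_subspace subspace_span)
  show ?thesis
    unfolding closed_span_def
  proof (rule Real_Vector_Spaces.subspaceI)
    show "0 \<in> closure (span S)"
      using span_zero closure_subset by blast
  next
    fix x y
    assume "x \<in> closure (span S)" "y \<in> closure (span S)"
    then obtain f g where "\<forall>n. f n \<in> span S" "f \<longlonglongrightarrow> x" "\<forall>n. g n \<in> span S" "g \<longlonglongrightarrow> y"
      unfolding closure_sequential by blast
    then show "x + y \<in> closure (span S)"
      unfolding closure_sequential
      by (intro exI[of _ "\<lambda>n. f n + g n"]) (auto intro: tendsto_add span_add)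
  next
    fix c x
    assume "x \<in> closure (span S)"
    then obtain f where "\<forall>n. f n \<in> span S" "f \<longlonglongrightarrow> x"
      unfolding closure_sequential by blast
    then show "c *\<^sub>R x \<in> closure (span S)"
      unfolding closure_sequential
      by (intro exI[of _ "\<lambda>n. c *\<^sub>R f n"])
        (auto intro: tendsto_scaleR Real_Vector_Spaces.subspace_scale[OF S])
  qed
qed

end

section \<open>Eliminating the subspaces indexed by \<open>\<Lambda>'\<close>\<close>

theorem theorem6p3:
  fixes smul :: "'k::real_normed_field \<Rightarrow> 'a::banach \<Rightarrow> 'a"
    and \<Lambda> \<Lambda>' :: "'i set"
    and X :: "'i \<Rightarrow> 'a set"
  assumes "banach_over smul"
    and "\<Lambda> \<noteq> {}"
    and "arfs smul \<Lambda> X"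
    and "\<Lambda>' \<subseteq> \<Lambda>"
    and "\<And>\<delta>::real. \<delta> > 0 \<Longrightarrow>
           \<exists>L. closed_subspace smul L \<and>
               L \<subseteq> module.span smul (\<Union>i\<in>\<Lambda> - \<Lambda>'. X i) \<and>
               rho0 (closed_span smul (\<Union>i\<in>\<Lambda>'. X i)) L < \<delta>"
  shows "arfs smul (\<Lambda> - \<Lambda>') X"
proof -
  interpret banach_over smul by fact
  let ?J = "\<Lambda> - \<Lambda>'"
  let ?Y = "closed_span smul (\<Union>i\<in>\<Lambda>'. X i)"
  have cs: "closed_subspace smul (X i)" if "i \<in> \<Lambda>" for i
    using assms(3) that by (simp add: arfs_iff_abs_rep)
  interpret all: closed_subspaces X \<Lambda>
    using cs by unfold_locales (auto simp: closed_subspace_def subspace_imp_real_subspace)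
  interpret rest: closed_subspaces X ?J
    using all.subspace_X all.closed_X by unfold_locales auto
  obtain C where C: "C \<ge> 0" "\<And>x. abs_rep X \<Lambda> (C * norm x) x"
    using all.abs_rep_open_mapping[of UNIV] assms(3) by (auto simp: arfs_iff_abs_rep)
  \<comment> \<open>This ensures \<open>\<delta> * C \<le> 1 / 2\<close>; the summand 1 keeps the
    denominator positive when \<open>C = 0\<close>.\<close>
  define \<delta> where "\<delta> = 1 / (2 * (C + 1))"
  have "\<delta> > 0" using C(1) by (simp add: \<delta>_def)
  then obtain L where L: "closed_subspace smul L" "L \<subseteq> span (\<Union>i\<in>?J. X i)" "rho0 ?Y L < \<delta>"
    using assms(5) by blast
  have Lsub: "Real_Vector_Spaces.subspace L" and "closed L"
    using L(1) by (auto simp: closed_subspace_def subspace_imp_real_subspace)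
  \<comment> \<open>Here the algebraic span matters: every point of \<open>L\<close> has a
    representation over \<open>?J\<close>. The resulting \<open>M\<close> depends on
    \<open>L\<close>, which is harmless because the error bound involves only
    \<open>\<delta>\<close> and \<open>C\<close>.\<close>
  moreover have "\<exists>K. abs_rep X ?J K z" if "z \<in> L" for z
    using L(2) that cs by (intro span_imp_abs_rep) auto
  ultimately obtain M where M: "M \<ge> 0" "\<And>z. z \<in> L \<Longrightarrow> abs_rep X ?J (M * norm z) z"
    using rest.abs_rep_open_mapping[of L] by blast
  \<comment> \<open>\<open>C\<close> pays for \<open>w\<close>, and \<open>M * (C + 1)\<close> pays
    for \<open>z\<close>, whose norm is at most \<open>(C + 1) * norm x\<close>.\<close>
  define D where "D = C + M * (C + 1)"
  have D: "D \<ge> 0" using C(1) M(1) by (simp add: D_def)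
  have approx: "\<exists>a\<in>UNIV. abs_rep X ?J (D * norm x) a \<and> norm (x - a) \<le> norm x / 2" for x
  proof -
    obtain y w where yw: "x = y + w" "abs_rep X \<Lambda>' (C * norm x) y" "abs_rep X ?J (C * norm x) w"
      using abs_rep_Diff[OF C(2) assms(4)] .
    obtain z where z: "z \<in> L" "norm (y - z) \<le> \<delta> * norm y"
      using rho0_less_approx[OF real_subspace_closed_span Lsub L(3) abs_rep_in_closed_span[OF yw(2)]]
      by blast
    have y: "norm y \<le> C * norm x" by (rule abs_rep_norm_le[OF yw(2)])
    have "norm (y - z) \<le> \<delta> * (C * norm x)"
      using z(2) mult_left_mono[OF y, of \<delta>] \<open>\<delta> > 0\<close> by linarith
    also have "\<dots> \<le> norm x / 2"
    proof -
      have "\<delta> * C \<le> 1 / 2" using C(1) by (simp add: \<delta>_def field_simps)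
      then show ?thesis using mult_right_mono[of "\<delta> * C" "1 / 2" "norm x"] by simp
    qed
    finally have err: "norm (y - z) \<le> norm x / 2" .
    have "norm z \<le> norm y + norm (y - z)" by norm
    then have "norm z \<le> (C + 1) * norm x"
      using y err norm_ge_zero[of x] unfolding distrib_right mult_1 by linarith
    then have "M * norm z \<le> M * ((C + 1) * norm x)" by (intro mult_left_mono M(1))
    then have "abs_rep X ?J (M * ((C + 1) * norm x)) z"
      by (rule abs_rep_mono[OF M(2)[OF z(1)]])
    then have "abs_rep X ?J (D * norm x) (w + z)"
      using rest.abs_rep_add[OF yw(3), of "M * ((C + 1) * norm x)" z]
      by (simp add: D_def distrib_right mult.assoc)
    moreover have "x - (w + z) = y - z" by (simp add: yw(1))
    ultimately show ?thesis using err by (metis UNIV_I)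
  qed
  \<comment> \<open>The approximants \<open>w + z\<close> use only indices in \<open>?J\<close>, so
    iterating on the whole space represents \<open>x\<close> exactly over \<open>?J\<close>.\<close>
  have "\<exists>K. abs_rep X ?J K x" for x
    using rest.abs_rep_iterate[of UNIV D x] D approx by blast
  then show ?thesis using cs by (simp add: arfs_iff_abs_rep)
qed

end
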